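(* Let $\mathfrak{g}$ be a real or complex Lie algebra with a decomposition $$\mathfrak{g}=\bigoplus_{j=1}^k\mathfrak{g}_j$$ into $k$ indecomposable ideals $\mathfrak{g}_j$ such that $[\mathfrak{g}_j,\mathfrak{g}_j]\neq0$ for all $j$. For every $1\le l\le k$ there exists an inner product $\langle\cdot,\cdot\rangle_l$ on $\mathfrak{g}$ such that the metric Lie algebra $(\mathfrak{g},\langle\cdot,\cdot\rangle_l)$ has exactly $l$ irreducible components.
   Context: All Lie algebras are finite-dimensional. A Lie algebra is indecomposable if it cannot be written as a direct sum of ideals $\mathfrak{g}_1\oplus\mathfrak{g}_2$ with $\mathfrak{g}_1\neq0\neq\mathfrak{g}_2$ (no inner product involved). An inner product on a real (resp. complex) Lie algebra is a positive definite symmetric bilinear (resp. Hermitian) form; a Lie algebra with an inner product is a metric Lie algebra. A factor of a metric Lie algebra is an ideal whose orthogonal complement is also an ideal; a non-zero metric Lie algebra is irreducible if its only factors are $0$ and itself. The irreducible components of a metric Lie algebra with no non-zero abelian factor are the summands of its orthogonal decomposition (direct sum of pairwise orthogonal ideals) into irreducible factors; this decomposition is unique up to order. *)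

theory Defs
  imports Complex_Main
begin

text \<open>
  The Lie algebra is a whole type. Its ideals are Lie algebras in their own right, so the notions
  below take the (sub)algebra \<open>L\<close> in which they are understood as an argument; \<open>L = UNIV\<close> gives
  the notion for the Lie algebra itself.
\<close>

definition direct_sum_of :: "'v::ab_group_add set \<Rightarrow> 'i set \<Rightarrow> ('i \<Rightarrow> 'v set) \<Rightarrow> bool" where
  "direct_sum_of L I F \<longleftrightarrow>
     finite I \<and>
     L = {\<Sum>i\<in>I. f i | f. \<forall>i\<in>I. f i \<in> F i} \<and>
     (\<forall>f. (\<forall>i\<in>I. f i \<in> F i) \<longrightarrow> (\<Sum>i\<in>I. f i) = 0 \<longrightarrow> (\<forall>i\<in>I. f i = 0))"

locale fin_dim_lie_algebra = vector_space scale
  for scale :: "'k::field \<Rightarrow> 'v::ab_group_add \<Rightarrow> 'v" +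
  fixes br :: "'v \<Rightarrow> 'v \<Rightarrow> 'v"
  assumes fin_dim: "\<exists>S. finite S \<and> span S = UNIV"
    and br_add_left: "br (x + y) z = br x z + br y z"
    and br_add_right: "br x (y + z) = br x y + br x z"
    and br_scale_left: "br (scale c x) y = scale c (br x y)"
    and br_scale_right: "br x (scale c y) = scale c (br x y)"
    and br_self: "br x x = 0"
    and jacobi: "br x (br y z) + br y (br z x) + br z (br x y) = 0"
begin

definition lie_ideal :: "'v set \<Rightarrow> 'v set \<Rightarrow> bool" where
  "lie_ideal L I \<longleftrightarrow> subspace I \<and> I \<subseteq> L \<and> (\<forall>x\<in>L. \<forall>y\<in>I. br x y \<in> I)"

definition bracket :: "'v set \<Rightarrow> 'v set \<Rightarrow> 'v set" where
  "bracket A B = span {br x y | x y. x \<in> A \<and> y \<in> B}"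

definition indecomposable :: "'v set \<Rightarrow> bool" where
  "indecomposable L \<longleftrightarrow>
     \<not> (\<exists>I J. lie_ideal L I \<and> lie_ideal L J \<and> I \<noteq> {0} \<and> J \<noteq> {0} \<and>
            I \<inter> J = {0} \<and> L = {x + y | x y. x \<in> I \<and> y \<in> J})"

definition indecomposable_decomposition :: "nat \<Rightarrow> (nat \<Rightarrow> 'v set) \<Rightarrow> bool" where
  "indecomposable_decomposition k g \<longleftrightarrow>
     direct_sum_of UNIV {1..k} g \<and>
     (\<forall>j\<in>{1..k}. lie_ideal UNIV (g j) \<and> indecomposable (g j))"

definition orth_compl :: "('v \<Rightarrow> 'v \<Rightarrow> 'k) \<Rightarrow> 'v set \<Rightarrow> 'v set \<Rightarrow> 'v set" where
  "orth_compl ip L A = {x\<in>L. \<forall>y\<in>A. ip x y = 0}"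

definition factor :: "('v \<Rightarrow> 'v \<Rightarrow> 'k) \<Rightarrow> 'v set \<Rightarrow> 'v set \<Rightarrow> bool" where
  "factor ip L I \<longleftrightarrow> lie_ideal L I \<and> lie_ideal L (orth_compl ip L I)"

definition metric_irreducible :: "('v \<Rightarrow> 'v \<Rightarrow> 'k) \<Rightarrow> 'v set \<Rightarrow> bool" where
  "metric_irreducible ip L \<longleftrightarrow> L \<noteq> {0} \<and> (\<forall>I. factor ip L I \<longrightarrow> I = {0} \<or> I = L)"

definition no_abelian_factor :: "('v \<Rightarrow> 'v \<Rightarrow> 'k) \<Rightarrow> bool" where
  "no_abelian_factor ip \<longleftrightarrow> (\<forall>I. factor ip UNIV I \<and> bracket I I = {0} \<longrightarrow> I = {0})"

text \<open>
  The summands of a direct sum of non-zero subspaces are pairwise distinct, so a decomposition up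
  to order is just a set of subspaces.
\<close>

definition irreducible_decomposition :: "('v \<Rightarrow> 'v \<Rightarrow> 'k) \<Rightarrow> 'v set set \<Rightarrow> bool" where
  "irreducible_decomposition ip C \<longleftrightarrow>
     direct_sum_of UNIV C (\<lambda>M. M) \<and>
     (\<forall>M\<in>C. factor ip UNIV M \<and> metric_irreducible ip M) \<and>
     (\<forall>M\<in>C. \<forall>N\<in>C. M \<noteq> N \<longrightarrow> (\<forall>x\<in>M. \<forall>y\<in>N. ip x y = 0))"

text \<open>
  Irreducible components are only defined in the absence of non-zero abelian factors, and are the
  summands of \<^emph>\<open>the\<close> orthogonal decomposition into irreducible factors; both conditions are part
  of the following predicate.
\<close>

definition has_exactly_irreducible_components :: "('v \<Rightarrow> 'v \<Rightarrow> 'k) \<Rightarrow> nat \<Rightarrow> bool" where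
  "has_exactly_irreducible_components ip l \<longleftrightarrow>
     no_abelian_factor ip \<and>
     (\<exists>C. irreducible_decomposition ip C \<and>
          (\<forall>D. irreducible_decomposition ip D \<longrightarrow> D = C) \<and>
          card C = l)"

end

definition real_inner_product ::
    "(real \<Rightarrow> 'v::ab_group_add \<Rightarrow> 'v) \<Rightarrow> ('v \<Rightarrow> 'v \<Rightarrow> real) \<Rightarrow> bool" where
  "real_inner_product scale ip \<longleftrightarrow>
     (\<forall>x y z. ip (x + y) z = ip x z + ip y z) \<and>
     (\<forall>c x y. ip (scale c x) y = c * ip x y) \<and>
     (\<forall>x y. ip y x = ip x y) \<and>
     (\<forall>x. x \<noteq> 0 \<longrightarrow> ip x x > 0)"

text \<open>
  Hermitian forms are linear in the first and conjugate-linear in the second argument; the values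
  \<open>ip x x\<close> are real by the symmetry condition.
\<close>

definition complex_inner_product ::
    "(complex \<Rightarrow> 'v::ab_group_add \<Rightarrow> 'v) \<Rightarrow> ('v \<Rightarrow> 'v \<Rightarrow> complex) \<Rightarrow> bool" where
  "complex_inner_product scale ip \<longleftrightarrow>
     (\<forall>x y z. ip (x + y) z = ip x z + ip y z) \<and>
     (\<forall>c x y. ip (scale c x) y = c * ip x y) \<and>
     (\<forall>x y. ip y x = cnj (ip x y)) \<and>
     (\<forall>x. x \<noteq> 0 \<longrightarrow> Re (ip x x) > 0)"

end

theory Submission
  imports Defs
begin

text \<open>
  The summands \<open>g\<^sub>1, \<dots>, g\<^sub>k\<close> are distributed over \<open>l\<close> non-empty blocks, and the inner product is
  chosen such that distinct blocks are orthogonal, while any two summands of one block are linked: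
  some element of \<open>[g\<^sub>i, g\<^sub>i]\<close> is not orthogonal to some element of \<open>[g\<^sub>j, g\<^sub>j]\<close>. The irreducible
  components are then exactly the sums of the blocks. Such a form is an orthogonal sum of inner
  products on the \<open>g\<^sub>j\<close> plus one positive semidefinite term \<open>\<nu>(x) \<cdot> cj (\<nu>(y))\<close> for every block, where
  \<open>cj\<close> is the conjugation of the scalars and the functional \<open>\<nu>\<close> vanishes on the other blocks and is non-zero on a chosen vector of each
  \<open>[g\<^sub>j, g\<^sub>j]\<close> in its own block (\<open>block_metric_exists\<close>).

  To see that a factor \<open>I\<close> of the resulting metric Lie algebra must be a sum of blocks, consider the
  orthogonal projection \<open>p\<close> onto \<open>I\<close>. Both \<open>I\<close> and its orthogonal complement are ideals, so \<open>p\<close> is an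
  idempotent of the centroid: it commutes with all \<open>ad x\<close>. A central element of \<open>g\<^sub>j\<close> outside
  \<open>[g\<^sub>j, g\<^sub>j]\<close> would split off a line from \<open>g\<^sub>j\<close>; as \<open>g\<^sub>j\<close> is indecomposable and not abelian, its
  centre lies in \<open>[g\<^sub>j, g\<^sub>j]\<close> (\<open>indecomposable_center_subset_bracket\<close>). On the other hand, an element
  of the centroid whose values are central vanishes on brackets. The component of \<open>p\<close> from one
  summand to a different one has central values, because distinct summands commute; by the two
  facts it vanishes on the centre of its source, so composites of such components are zero. This makes
  the component \<open>g\<^sub>j \<rightarrow> g\<^sub>j\<close> of \<open>p\<close> idempotent, hence \<open>0\<close> or \<open>1\<close> by indecomposability, and \<open>p\<close> agrees
  with it on \<open>g\<^sub>j\<close> up to central elements (\<open>idempotent_centroid_dichotomy\<close>).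

  So \<open>p = \<Phi> + N\<close>, where \<open>\<Phi>\<close> is the sum of the projections to those \<open>g\<^sub>j\<close> with component \<open>1\<close>, and \<open>N\<close>
  has central values; the same two facts give \<open>N\<^sup>2 = 0\<close>. On \<open>[g\<^sub>j, g\<^sub>j]\<close> the projection \<open>p\<close> is \<open>0\<close> or \<open>1\<close>,
  so \<open>[g\<^sub>j, g\<^sub>j]\<close> lies in \<open>I\<close> or in its orthogonal complement, and linked summands lie on the same
  side. Thus \<open>\<Phi>\<close> is constant on blocks, and it is self-adjoint since blocks are orthogonal. Then
  \<open>N\<close> is self-adjoint with square \<open>0\<close>, so \<open>N = 0\<close> and \<open>p = \<Phi>\<close> (\<open>factor_projection_explicit\<close>).
  Consequently every factor contains each block or is orthogonal to it, and the irreducibility of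
  the blocks, the absence of abelian factors and the uniqueness of the decomposition all follow.
\<close>

section \<open>Hermitian forms\<close>

text \<open>
  The argument is the same over the reals and the complex numbers. All it uses of the scalars is
  an involutive automorphism \<open>cj\<close> and an additively closed set of positive scalars that omits \<open>0\<close> and
  contains \<open>c * cj c\<close> for all \<open>c \<noteq> 0\<close>: the identity and \<open>a > 0\<close> in the real case, \<open>cnj\<close> and \<open>Re a > 0\<close> in the complex one.
\<close>

locale positive_conjugation =
  fixes cj :: "'k::field \<Rightarrow> 'k" and pos :: "'k \<Rightarrow> bool"
  assumes cj_add: "cj (a + b) = cj a + cj b"
    and cj_mult: "cj (a * b) = cj a * cj b"
    and cj_cj: "cj (cj a) = a"
    and pos_add: "pos a \<Longrightarrow> pos b \<Longrightarrow> pos (a + b)"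
    and not_pos_zero: "\<not> pos 0"
    and pos_norm: "c \<noteq> 0 \<Longrightarrow> pos (c * cj c)"
begin

lemma cj_zero [simp]: "cj 0 = 0"
proof -
  have "cj 0 + 0 = cj 0 + cj 0" using cj_add[of 0 0] by simp
  then show ?thesis by (simp only: add_left_cancel)
qed

lemma cj_eq_zero [simp]: "cj a = 0 \<longleftrightarrow> a = 0"
  by (metis cj_cj cj_zero)

lemma cj_sum: "cj (\<Sum>i\<in>A. f i) = (\<Sum>i\<in>A. cj (f i))"
  by (induction A rule: infinite_finite_induct) (simp_all add: cj_add)

definition nonneg :: "'k \<Rightarrow> bool" where
  "nonneg a \<longleftrightarrow> a = 0 \<or> pos a"

lemma nonneg_add: "nonneg a \<Longrightarrow> nonneg b \<Longrightarrow> nonneg (a + b)"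
  by (auto simp: nonneg_def pos_add)

lemma nonneg_sum: "(\<And>i. i \<in> A \<Longrightarrow> nonneg (f i)) \<Longrightarrow> nonneg (\<Sum>i\<in>A. f i)"
  by (induction A rule: infinite_finite_induct) (simp_all add: nonneg_add, simp_all add: nonneg_def)

lemma pos_add_nonneg: "pos a \<Longrightarrow> nonneg b \<Longrightarrow> pos (a + b)"
  by (auto simp: nonneg_def pos_add)

lemma pos_sum:
  assumes "finite A" "\<And>i. i \<in> A \<Longrightarrow> nonneg (f i)" "a \<in> A" "pos (f a)"
  shows "pos (\<Sum>i\<in>A. f i)"
proof -
  have "nonneg (\<Sum>i\<in>A - {a}. f i)" using assms(2) by (intro nonneg_sum) auto
  then show ?thesis using assms(1,3,4) by (simp add: sum.remove[of A a] pos_add_nonneg)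
qed

lemma nonneg_norm: "nonneg (c * cj c)"
  using pos_norm by (cases "c = 0") (auto simp: nonneg_def)

end

locale hermitian_space = vector_space scale + positive_conjugation cj pos
  for scale :: "'k::field \<Rightarrow> 'v::ab_group_add \<Rightarrow> 'v" and cj :: "'k \<Rightarrow> 'k" and pos :: "'k \<Rightarrow> bool"
begin

definition inner_product :: "('v \<Rightarrow> 'v \<Rightarrow> 'k) \<Rightarrow> bool" where
  "inner_product ip \<longleftrightarrow>
     (\<forall>x y z. ip (x + y) z = ip x z + ip y z) \<and>
     (\<forall>c x y. ip (scale c x) y = c * ip x y) \<and>
     (\<forall>x y. ip y x = cj (ip x y)) \<and>
     (\<forall>x. x \<noteq> 0 \<longrightarrow> pos (ip x x))"

context
  fixes ip assumes ip: "inner_product ip"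
begin

lemma ip_add_left: "ip (x + y) z = ip x z + ip y z"
  and ip_scale_left: "ip (scale c x) y = c * ip x y"
  and ip_swap: "ip y x = cj (ip x y)"
  and ip_pos: "x \<noteq> 0 \<Longrightarrow> pos (ip x x)"
  using ip unfolding inner_product_def by blast+

lemma ip_add_right: "ip z (x + y) = ip z x + ip z y"
  by (metis ip_add_left ip_swap cj_add)

lemma ip_scale_right: "ip x (scale c y) = cj c * ip x y"
  by (metis ip_scale_left ip_swap cj_mult)

lemma ip_zero_left [simp]: "ip 0 x = 0"
  using ip_scale_left[of 0 0 x] by simp

lemma ip_zero_right [simp]: "ip x 0 = 0"
  using ip_scale_right[of x 0 0] by simp

lemma ip_diff_left: "ip (x - y) z = ip x z - ip y z"
  using ip_add_left[of "x - y" y z] by (simp add: eq_diff_eq)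

lemma ip_diff_right: "ip z (x - y) = ip z x - ip z y"
  using ip_add_right[of z "x - y" y] by (simp add: eq_diff_eq)

lemma ip_sum_left: "ip (\<Sum>i\<in>A. f i) z = (\<Sum>i\<in>A. ip (f i) z)"
  by (induction A rule: infinite_finite_induct) (simp_all add: ip_add_left)

lemma ip_sum_right: "ip z (\<Sum>i\<in>A. f i) = (\<Sum>i\<in>A. ip z (f i))"
  by (induction A rule: infinite_finite_induct) (simp_all add: ip_add_right)

lemma ip_self_eq_zero: "ip x x = 0 \<longleftrightarrow> x = 0"
  using ip_pos[of x] not_pos_zero by (cases "x = 0") auto

lemma ip_nonneg: "nonneg (ip x x)"
  using ip_pos[of x] by (cases "x = 0") (auto simp: nonneg_def)

lemma ip_orthogonal_sym: "ip x y = 0 \<longleftrightarrow> ip y x = 0"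
  by (metis ip_swap cj_eq_zero)

text \<open>
  Gram-Schmidt: the new generator is replaced by its component orthogonal to the previous span.
\<close>

lemma orthogonal_projection_span:
  assumes "finite S"
  shows "\<exists>a\<in>span S. \<forall>y\<in>span S. ip (x - a) y = 0"
  using assms
proof (induction S arbitrary: x)
  case empty
  then show ?case by simp
next
  case (insert s S)
  obtain b where b: "b \<in> span S" "\<And>y. y \<in> span S \<Longrightarrow> ip (s - b) y = 0"
    using insert.IH[of s] by blast
  obtain a where a: "a \<in> span S" "\<And>y. y \<in> span S \<Longrightarrow> ip (x - a) y = 0"
    using insert.IH[of x] by blast
  define t where "t = s - b"
  have sub: "span S \<subseteq> span (insert s S)" by (simp add: span_mono subset_insertI)
  have t: "t \<in> span (insert s S)"
    unfolding t_def using b(1) sub by (meson insertI1 span_base span_diff subsetD)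
  \<comment> \<open>If \<open>t = 0\<close>, division by zero makes \<open>c\<close> vanish, so both cases are treated together.\<close>
  define c where "c = ip (x - a) t / ip t t"
  let ?a = "a + scale c t"
  have ct: "c * ip t t = ip (x - a) t"
    by (cases "t = 0") (simp_all add: c_def ip_self_eq_zero)
  have "ip (x - ?a) y = 0" if y_in: "y \<in> span (insert s S)" for y
  proof -
    obtain d where d: "y - scale d s \<in> span S"
      using y_in span_breakdown_eq[of y s S] by blast
    define u where "u = y - scale d s + scale d b"
    have u: "u \<in> span S" unfolding u_def using d b(1) by (simp add: span_add span_scale)
    have y: "y = u + scale d t" by (simp add: u_def t_def scale_right_diff_distrib)
    have "ip t u = 0" using b(2) u t_def by blast
    moreover have "ip (x - a) u = 0" using a(2) u by blast
    moreover have "x - ?a = (x - a) - scale c t" by simp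
    ultimately have "ip (x - ?a) u = 0" "ip (x - ?a) t = 0"
      by (simp_all only: ip_diff_left ip_scale_left ct) simp_all
    then show ?thesis by (simp add: y ip_add_right ip_scale_right)
  qed
  moreover have "?a \<in> span (insert s S)" using a(1) sub t by (meson span_add span_scale subsetD)
  ultimately show ?case by blast
qed

end

text \<open>
  The standard form in the coordinates of a basis.
\<close>

lemma inner_product_exists:
  assumes "finite S" "span S = UNIV"
  shows "\<exists>ip. inner_product ip"
proof -
  obtain B where B: "independent B" "B \<subseteq> S" "S \<subseteq> span B"
    by (rule maximal_independent_subset)
  have fB: "finite B" using B(2) assms(1) finite_subset by blast
  have "span S \<subseteq> span B" using B(3) by (intro span_minimal) auto
  then have sB: "x \<in> span B" for x using assms(2) by auto
  let ?r = "representation B"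
  define e where "e x y = (\<Sum>b\<in>B. ?r x b * cj (?r y b))" for x y
  have "pos (e x x)" if "x \<noteq> 0" for x
  proof -
    have "(\<Sum>b\<in>B. scale (?r x b) b) = x"
      using sum_representation_eq[OF B(1) sB fB] by simp
    then obtain b where "b \<in> B" "?r x b \<noteq> 0"
      using \<open>x \<noteq> 0\<close> by (metis (mono_tags, lifting) scale_zero_left sum.neutral)
    then show ?thesis unfolding e_def
      using fB nonneg_norm pos_norm by (intro pos_sum) auto
  qed
  moreover have "e (x + y) z = e x z + e y z" for x y z
    by (simp add: e_def representation_add[OF B(1) sB sB] distrib_right sum.distrib)
  moreover have "e (scale c x) y = c * e x y" for c x y
    by (simp add: e_def representation_scale[OF B(1) sB] sum_distrib_left mult.assoc)
  moreover have "e y x = cj (e x y)" for x y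
    by (simp add: e_def cj_sum cj_mult cj_cj mult.commute)
  ultimately have "inner_product e" unfolding inner_product_def by blast
  then show ?thesis by blast
qed

end

section \<open>The centroid and the centre\<close>

context fin_dim_lie_algebra
begin

lemma br_zero_left [simp]: "br 0 x = 0"
  using br_add_left[of 0 0 x] by simp

lemma br_zero_right [simp]: "br x 0 = 0"
  using br_add_right[of x 0 0] by simp

lemma br_diff_right: "br x (y - z) = br x y - br x z"
  using br_add_right[of x "y - z" z] by (simp add: eq_diff_eq)

lemma br_sum_left: "br (\<Sum>i\<in>A. f i) y = (\<Sum>i\<in>A. br (f i) y)"
  by (induction A rule: infinite_finite_induct) (simp_all add: br_add_left)

lemma br_sum_right: "br x (\<Sum>i\<in>A. f i) = (\<Sum>i\<in>A. br x (f i))"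
  by (induction A rule: infinite_finite_induct) (simp_all add: br_add_right)

lemma br_anticomm: "br x y = - br y x"
proof -
  have "br (x + y) (x + y) = br x y + br y x"
    by (simp add: br_add_left br_add_right br_self[of x] br_self[of y] add.commute)
  then have "br x y + br y x = 0" by (simp only: br_self)
  then show ?thesis by (simp add: eq_neg_iff_add_eq_0)
qed

definition central :: "'v \<Rightarrow> bool" where
  "central z \<longleftrightarrow> (\<forall>y. br y z = 0)"

lemma central_add: "central x \<Longrightarrow> central y \<Longrightarrow> central (x + y)"
  by (simp add: central_def br_add_right)

lemma central_zero [simp]: "central 0"
  by (simp add: central_def)

lemma central_sum: "(\<And>i. i \<in> A \<Longrightarrow> central (f i)) \<Longrightarrow> central (\<Sum>i\<in>A. f i)"
  by (induction A rule: infinite_finite_induct) (simp_all add: central_add)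

text \<open>
  The centroid of a Lie algebra consists of the linear endomorphisms that commute with every \<open>ad x\<close>.
\<close>

definition in_centroid :: "('v \<Rightarrow> 'v) \<Rightarrow> bool" where
  "in_centroid p \<longleftrightarrow>
     (\<forall>x y. p (x + y) = p x + p y) \<and>
     (\<forall>c x. p (scale c x) = scale c (p x)) \<and>
     (\<forall>x y. p (br x y) = br x (p y))"

lemma in_centroidD:
  assumes "in_centroid p"
  shows centroid_add: "p (x + y) = p x + p y"
    and centroid_scale: "p (scale c x) = scale c (p x)"
    and centroid_br: "p (br x y) = br x (p y)"
  using assms by (auto simp: in_centroid_def)

lemma centroid_zero: "in_centroid p \<Longrightarrow> p 0 = 0"
  using centroid_add[of p 0 0] by simp

lemma centroid_diff: "in_centroid p \<Longrightarrow> p (x - y) = p x - p y"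
  using centroid_add[of p "x - y" y] by (simp add: eq_diff_eq)

lemma centroid_sum_apply: "in_centroid p \<Longrightarrow> p (\<Sum>i\<in>A. f i) = (\<Sum>i\<in>A. p (f i))"
  by (induction A rule: infinite_finite_induct) (simp_all add: centroid_add centroid_zero)

lemma in_centroid_compose: "in_centroid p \<Longrightarrow> in_centroid q \<Longrightarrow> in_centroid (\<lambda>x. p (q x))"
  by (simp add: in_centroid_def)

lemma in_centroid_diff: "in_centroid p \<Longrightarrow> in_centroid q \<Longrightarrow> in_centroid (\<lambda>x. p x - q x)"
  by (simp add: in_centroid_def scale_right_diff_distrib br_diff_right)

lemma in_centroid_sum:
  "(\<And>i. i \<in> A \<Longrightarrow> in_centroid (p i)) \<Longrightarrow> in_centroid (\<lambda>x. \<Sum>i\<in>A. p i x)"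
proof (induction A rule: infinite_finite_induct)
  case (insert a A)
  then have "in_centroid (p a)" "in_centroid (\<lambda>x. \<Sum>i\<in>A. p i x)" by auto
  with insert.hyps show ?case
    by (simp add: in_centroid_def br_add_right scale_right_distrib algebra_simps)
qed (simp_all add: in_centroid_def)

lemma in_centroid_id: "in_centroid (\<lambda>x. x)"
  by (simp add: in_centroid_def)

lemma bracket_least:
  assumes "subspace S" "\<And>x y. x \<in> A \<Longrightarrow> y \<in> B \<Longrightarrow> br x y \<in> S"
  shows "bracket A B \<subseteq> S"
  unfolding bracket_def using assms by (intro span_minimal) auto

lemma br_in_bracket: "x \<in> A \<Longrightarrow> y \<in> B \<Longrightarrow> br x y \<in> bracket A B"
  unfolding bracket_def by (intro span_base) auto

lemma bracket_mono: "A \<subseteq> A' \<Longrightarrow> B \<subseteq> B' \<Longrightarrow> bracket A B \<subseteq> bracket A' B'"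
  unfolding bracket_def by (intro span_mono) auto

lemma subspace_centroid_preimage:
  "in_centroid p \<Longrightarrow> subspace S \<Longrightarrow> subspace {x. p x \<in> S}"
  by (simp add: subspace_def centroid_add centroid_scale centroid_zero)

text \<open>
  For a central value \<open>p y\<close>, one has \<open>p [x, y] = [x, p y] = 0\<close>.
\<close>

lemma centroid_kills_bracket:
  assumes "in_centroid p" "\<And>x. x \<in> B \<Longrightarrow> central (p x)" "z \<in> bracket A B"
  shows "p z = 0"
proof -
  have "bracket A B \<subseteq> {x. p x \<in> {0}}"
    using assms(1,2)
    by (intro bracket_least subspace_centroid_preimage)
      (auto simp: centroid_br central_def)
  then show ?thesis using assms(3) by auto
qed

text \<open>
  An ideal need not be invariant under the centroid, but its derived ideal is mapped into it, since
  \<open>p [x, y] = [x, p y]\<close>.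
\<close>

lemma centroid_bracket_ideal:
  assumes "in_centroid p" "lie_ideal UNIV I" "z \<in> bracket I I"
  shows "p z \<in> I"
proof -
  have "br x (p y) \<in> I" if "x \<in> I" for x y
  proof -
    have "br (p y) x \<in> I" using assms(2) that by (simp add: lie_ideal_def)
    then show ?thesis
      using assms(2) br_anticomm[of x "p y"] subspace_neg by (auto simp: lie_ideal_def)
  qed
  then have "bracket I I \<subseteq> {x. p x \<in> I}"
    using assms(1,2)
    by (intro bracket_least subspace_centroid_preimage)
      (auto simp: centroid_br lie_ideal_def)
  then show ?thesis using assms(3) by auto
qed

text \<open>
  Every subspace that contains \<open>[L, L]\<close> is an ideal of \<open>L\<close>. If a central \<open>z\<close> were outside \<open>[L, L]\<close>, then
  a complement \<open>K\<close> of the line through \<open>z\<close> that contains \<open>[L, L]\<close> would decompose \<open>L\<close>; it is non-zero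
  because \<open>L\<close> is not abelian.
\<close>

lemma indecomposable_center_subset_bracket:
  assumes L: "subspace L" "indecomposable L" "bracket L L \<noteq> {0}"
    and closed: "\<And>x y. x \<in> L \<Longrightarrow> y \<in> L \<Longrightarrow> br x y \<in> L"
    and z: "z \<in> L" "\<And>y. y \<in> L \<Longrightarrow> br y z = 0"
  shows "z \<in> bracket L L"
proof (rule ccontr)
  assume nz: "z \<notin> bracket L L"
  have sb: "subspace (bracket L L)" by (simp add: bracket_def)
  have bL: "bracket L L \<subseteq> L" using L(1) closed by (rule bracket_least)
  obtain B where B: "B \<subseteq> bracket L L" "independent B" "bracket L L \<subseteq> span B"
    using maximal_independent_subset by blast
  have spB: "span B = bracket L L"
    using B sb by (simp add: span_minimal subset_antisym)
  have "independent (insert z B)"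
    using B(2) nz spB by (simp add: independent_insertI)
  moreover have "insert z B \<subseteq> L" using B(1) bL z(1) by auto
  ultimately obtain B' where B': "insert z B \<subseteq> B'" "B' \<subseteq> L" "independent B'" "L \<subseteq> span B'"
    using maximal_independent_subset_extend by metis
  define K where "K = span (B' - {z})"
  have KL: "K \<subseteq> L" unfolding K_def using B'(2) L(1) by (intro span_minimal) auto
  have "z \<notin> B" using nz B(1) by auto
  then have "B \<subseteq> B' - {z}" using B'(1) by auto
  then have bK: "bracket L L \<subseteq> K" unfolding K_def by (metis spB span_mono)
  have zK: "z \<notin> K"
    using B'(1,3) unfolding K_def dependent_def by blast
  have zL: "span {z} \<subseteq> L" using z(1) L(1) by (intro span_minimal) auto
  have "lie_ideal L K"
    using KL bK br_in_bracket[of _ L _ L] by (auto simp: lie_ideal_def K_def)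
  moreover have "lie_ideal L (span {z})"
  proof -
    have "br x (scale c z) = 0" if "x \<in> L" for c x using z(2) that by (simp add: br_scale_right)
    then have "br x y \<in> span {z}" if "x \<in> L" "y \<in> span {z}" for x y
      using that by (auto simp: span_singleton span_zero intro: range_eqI[of _ _ 0])
    then show ?thesis using zL by (simp add: lie_ideal_def)
  qed
  moreover have "K \<noteq> {0}" using bK L(3) sb by (metis subspace_0 subset_singletonD empty_iff)
  moreover have "span {z} \<noteq> {0}" using zK by (metis K_def singletonD span_base singletonI span_zero)
  moreover have "K \<inter> span {z} = {0}"
  proof -
    have "scale c z = 0" if "scale c z \<in> K" for c
    proof (cases "c = 0")
      case False
      then have "z = scale (inverse c) (scale c z)" by simp
      then have "z \<in> K" using that by (metis K_def span_scale)
      then show ?thesis using zK by blast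
    qed simp
    then show ?thesis by (auto simp: span_singleton K_def span_zero intro: range_eqI[of _ _ 0])
  qed
  moreover have "L = {x + y | x y. x \<in> K \<and> y \<in> span {z}}"
  proof -
    have "\<exists>x y. v = x + y \<and> x \<in> K \<and> y \<in> span {z}" if "v \<in> L" for v
    proof -
      have "v \<in> span (insert z (B' - {z}))"
        using that B'(1,4) by (metis insert_Diff insert_subset subsetD)
      then obtain c where "v - scale c z \<in> K"
        unfolding K_def using span_breakdown_eq by blast
      moreover have "scale c z \<in> span {z}" by (simp add: span_base span_scale)
      ultimately show ?thesis by (metis diff_add_cancel)
    qed
    then show ?thesis using KL zL L(1) by (auto intro: subspace_add)
  qed
  ultimately show False using L(2) unfolding indecomposable_def by blast
qed

end

section \<open>Decompositions into indecomposable non-abelian ideals\<close>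

locale nonabelian_decomposition = fin_dim_lie_algebra scale br
  for scale :: "'k::field \<Rightarrow> 'v::ab_group_add \<Rightarrow> 'v" and br :: "'v \<Rightarrow> 'v \<Rightarrow> 'v" +
  fixes k :: nat and g :: "nat \<Rightarrow> 'v set"
  assumes decomposition: "indecomposable_decomposition k g"
    and nonabelian: "j \<in> {1..k} \<Longrightarrow> bracket (g j) (g j) \<noteq> {0}"
begin

\<comment> \<open>Otherwise the index set \<open>{1..k}\<close> would be rewritten to \<open>{Suc 0..k}\<close> and no longer match.\<close>
declare One_nat_def [simp del]

lemma g_ideal: "j \<in> {1..k} \<Longrightarrow> lie_ideal UNIV (g j)"
  and g_indecomposable: "j \<in> {1..k} \<Longrightarrow> indecomposable (g j)"
  and g_direct: "direct_sum_of UNIV {1..k} g"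
  using decomposition by (auto simp: indecomposable_decomposition_def)

lemma g_subspace: "j \<in> {1..k} \<Longrightarrow> subspace (g j)"
  using g_ideal by (auto simp: lie_ideal_def)

lemma br_in_g_right: "j \<in> {1..k} \<Longrightarrow> y \<in> g j \<Longrightarrow> br x y \<in> g j"
  using g_ideal by (auto simp: lie_ideal_def)

definition proj :: "nat \<Rightarrow> 'v \<Rightarrow> 'v" where
  "proj j x = (SOME f. (\<forall>i\<in>{1..k}. f i \<in> g i) \<and> (\<Sum>i=1..k. f i) = x) j"

lemma proj_spec: "(\<forall>i\<in>{1..k}. proj i x \<in> g i) \<and> (\<Sum>i=1..k. proj i x) = x"
proof -
  have "UNIV = {\<Sum>i=1..k. f i | f. \<forall>i\<in>{1..k}. f i \<in> g i}"
    using g_direct unfolding direct_sum_of_def by blast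
  then have "x \<in> {\<Sum>i=1..k. f i | f. \<forall>i\<in>{1..k}. f i \<in> g i}" using UNIV_I by (rule subst)
  then have "\<exists>f. (\<forall>i\<in>{1..k}. f i \<in> g i) \<and> (\<Sum>i=1..k. f i) = x" by blast
  from someI_ex[OF this] show ?thesis unfolding proj_def .
qed

lemma proj_in: "i \<in> {1..k} \<Longrightarrow> proj i x \<in> g i"
  and sum_proj: "(\<Sum>i=1..k. proj i x) = x"
  using proj_spec by auto

lemma proj_unique:
  assumes "\<And>i. i \<in> {1..k} \<Longrightarrow> f i \<in> g i" "(\<Sum>i=1..k. f i) = x" "j \<in> {1..k}"
  shows "proj j x = f j"
proof -
  have "\<forall>i\<in>{1..k}. proj i x - f i \<in> g i"
    using assms(1) proj_in g_subspace subspace_diff by blast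
  moreover have "(\<Sum>i=1..k. proj i x - f i) = 0"
    by (simp add: sum_subtractf sum_proj assms(2))
  ultimately have "\<forall>i\<in>{1..k}. proj i x - f i = 0"
    using g_direct unfolding direct_sum_of_def by meson
  then show ?thesis using assms(3) by simp
qed

lemma proj_of_g:
  assumes "i \<in> {1..k}" "j \<in> {1..k}" "x \<in> g j"
  shows "proj i x = (if i = j then x else 0)"
  using assms g_subspace
  by (intro proj_unique[where f = "\<lambda>i. if i = j then x else 0"])
    (auto simp: subspace_0)

lemma in_centroid_proj:
  assumes "j \<in> {1..k}" shows "in_centroid (proj j)"
proof -
  have "proj j (x + y) = proj j x + proj j y" for x y
    using assms proj_in g_subspace
    by (intro proj_unique[where f = "\<lambda>j. proj j x + proj j y"])
      (auto simp: subspace_add sum.distrib sum_proj)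
  moreover have "proj j (scale c x) = scale c (proj j x)" for c x
    using assms proj_in g_subspace
    by (intro proj_unique[where f = "\<lambda>j. scale c (proj j x)"])
      (auto simp: subspace_scale scale_sum_right[symmetric] sum_proj)
  moreover have "proj j (br x y) = br x (proj j y)" for x y
  proof (rule proj_unique[where f = "\<lambda>j. br x (proj j y)"])
    show "(\<Sum>i=1..k. br x (proj i y)) = br x y" by (simp add: br_sum_right[symmetric] sum_proj)
  qed (use assms proj_in br_in_g_right in auto)
  ultimately show ?thesis by (auto simp: in_centroid_def)
qed

lemma br_distinct_summands:
  assumes "i \<in> {1..k}" "j \<in> {1..k}" "i \<noteq> j" "x \<in> g i" "y \<in> g j"
  shows "br x y = 0"
proof -
  have "br x y = br x (proj j y)" using assms by (simp add: proj_of_g)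
  also have "\<dots> = proj j (br x y)" using assms by (simp add: centroid_br in_centroid_proj)
  also have "\<dots> = - proj j (br y x)"
    using assms(2) in_centroid_proj centroid_diff[of "proj j" 0 "br y x"]
    by (simp add: br_anticomm[of x y] centroid_zero)
  also have "proj j (br y x) = br y (proj j x)" using assms by (simp add: centroid_br in_centroid_proj)
  also have "\<dots> = 0" using assms by (simp add: proj_of_g)
  finally show ?thesis by simp
qed

lemma central_proj: "central z \<Longrightarrow> j \<in> {1..k} \<Longrightarrow> central (proj j z)"
  using centroid_br[OF in_centroid_proj] centroid_zero[OF in_centroid_proj]
  by (metis central_def)

text \<open>
  Both hypotheses on the summands, indecomposable and not abelian, enter here: together they
  confine the centre of each summand to its derived ideal.
\<close>

lemma central_in_summand_bracket:
  assumes "j \<in> {1..k}" "z \<in> g j" "central z"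
  shows "z \<in> bracket (g j) (g j)"
  using assms g_subspace g_indecomposable nonabelian br_in_g_right
  by (intro indecomposable_center_subset_bracket) (auto simp: central_def)

lemma central_in_bracket:
  assumes "central z" shows "z \<in> bracket UNIV UNIV"
proof -
  have "proj j z \<in> bracket UNIV UNIV" if "j \<in> {1..k}" for j
    using central_in_summand_bracket[OF that proj_in[OF that] central_proj[OF assms that]]
      bracket_mono[of "g j" UNIV "g j" UNIV] by auto
  then have "(\<Sum>j=1..k. proj j z) \<in> bracket UNIV UNIV"
    unfolding bracket_def by (intro span_sum) auto
  then show ?thesis by (simp add: sum_proj)
qed

text \<open>
  The component of \<open>p\<close> from \<open>g j\<close> to another \<open>g i\<close> has central values: for \<open>y\<close> in \<open>g i\<close>,
  \<open>[y, p x] = p [y, x] = 0\<close>.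
\<close>

lemma centroid_off_diagonal_central:
  assumes p: "in_centroid p" and j: "j \<in> {1..k}" and x: "x \<in> g j"
  shows "central (p x - proj j (p x))"
proof -
  let ?z = "p x - proj j (p x)"
  have "br y ?z = 0" if i: "i \<in> {1..k}" and y: "y \<in> g i" for i y
  proof (cases "i = j")
    case True
    have "?z = (\<Sum>l\<in>{1..k} - {j}. proj l (p x))"
      using sum_proj[of "p x"] j by (simp add: sum_diff1)
    moreover have "br (proj l (p x)) y = 0" if "l \<in> {1..k} - {j}" for l
      using that True i y proj_in br_distinct_summands[of l j] by auto
    ultimately have "br ?z y = 0" by (simp add: br_sum_left)
    then show ?thesis by (simp add: br_anticomm[of y])
  next
    case False
    have "br y (p x) = 0"
      using br_distinct_summands[OF i j False y x] p by (simp add: centroid_br[symmetric] centroid_zero)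
    then show ?thesis
      using br_distinct_summands[OF i j False y proj_in[OF j]] by (simp add: br_diff_right)
  qed
  then have "br (\<Sum>i=1..k. proj i y) ?z = 0" for y
    using proj_in by (simp add: br_sum_left)
  then show ?thesis by (simp add: central_def sum_proj)
qed

text \<open>
  The component \<open>\<phi> = proj j \<circ> p\<close> of \<open>p\<close> on \<open>g j\<close> is idempotent: the off-diagonal part of \<open>p x\<close> is a sum
  of central elements of the other \<open>g i\<close>, these lie in \<open>[g i, g i]\<close>, and \<open>p\<close> maps \<open>[g i, g i]\<close> into
  \<open>g i\<close>, so nothing returns to \<open>g j\<close>. Hence \<open>g j\<close> is the direct sum of the ideals \<open>image \<phi>\<close> and
  \<open>kernel \<phi>\<close>, and indecomposability leaves \<open>\<phi> = 0\<close> or \<open>\<phi> = 1\<close>.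
\<close>

lemma idempotent_centroid_dichotomy:
  assumes p: "in_centroid p" and idem: "\<And>x. p (p x) = p x" and j: "j \<in> {1..k}"
  shows "(\<forall>x\<in>g j. central (p x)) \<or> (\<forall>x\<in>g j. central (p x - x))"
proof -
  define \<phi> where "\<phi> x = proj j (p x)" for x
  have cen: "in_centroid \<phi>"
    unfolding \<phi>_def using in_centroid_compose[OF in_centroid_proj[OF j] p] .
  have \<phi>_in: "\<phi> x \<in> g j" for x unfolding \<phi>_def using j by (rule proj_in)
  have \<phi>_idem: "\<phi> (\<phi> x) = \<phi> x" if x: "x \<in> g j" for x
  proof -
    let ?z = "p x - \<phi> x"
    have z: "central ?z" unfolding \<phi>_def by (rule centroid_off_diagonal_central[OF p j x])
    have "\<phi> (proj i ?z) = 0" if i: "i \<in> {1..k}" for i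
    proof (cases "i = j")
      case True
      have "proj j ?z = 0"
        using j \<phi>_in by (simp add: centroid_diff in_centroid_proj proj_of_g[of j j]) (simp add: \<phi>_def)
      then show ?thesis using True cen by (simp add: centroid_zero)
    next
      case False
      have "proj i ?z \<in> bracket (g i) (g i)"
        by (intro central_in_summand_bracket i proj_in central_proj z)
      then have "p (proj i ?z) \<in> g i"
        using centroid_bracket_ideal[OF p g_ideal[OF i]] by blast
      then show ?thesis using False i j by (simp add: \<phi>_def proj_of_g)
    qed
    then have "\<phi> (\<Sum>i=1..k. proj i ?z) = 0" using cen by (simp add: centroid_sum_apply)
    then have "\<phi> (p x) = \<phi> (\<phi> x)" using cen by (simp add: sum_proj centroid_diff)
    moreover have "\<phi> (p x) = \<phi> x" by (simp add: \<phi>_def idem)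
    ultimately show ?thesis by simp
  qed
  let ?R = "\<phi> ` g j" and ?K = "{x \<in> g j. \<phi> x = 0}"
  have sub: "subspace (g j)" by (rule g_subspace[OF j])
  have "lie_ideal (g j) ?R"
  proof -
    have "subspace ?R"
      using sub cen unfolding subspace_def
      by (auto simp: centroid_add[symmetric] centroid_scale[symmetric] centroid_zero
          intro!: image_eqI[of 0 _ 0] imageI)
    moreover have "br x y \<in> ?R" if "y \<in> ?R" for x y
      using that cen br_in_g_right[OF j] by (auto simp: centroid_br[symmetric])
    ultimately show ?thesis using \<phi>_in by (auto simp: lie_ideal_def)
  qed
  moreover have "lie_ideal (g j) ?K"
    using sub cen br_in_g_right[OF j]
    by (auto simp: lie_ideal_def subspace_def centroid_add centroid_scale centroid_br centroid_zero)
  moreover have "?R \<inter> ?K = {0}"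
    using \<phi>_idem sub cen
    by (auto simp: subspace_0 centroid_zero intro!: image_eqI[of 0 _ 0])
  moreover have "g j = {x + y | x y. x \<in> ?R \<and> y \<in> ?K}"
  proof -
    have "x = \<phi> x + (x - \<phi> x) \<and> x - \<phi> x \<in> ?K" if "x \<in> g j" for x
      using that sub \<phi>_in cen \<phi>_idem by (simp add: subspace_diff centroid_diff)
    moreover have "x + y \<in> g j" if "x \<in> ?R" "y \<in> ?K" for x y
      using that \<phi>_in sub by (intro subspace_add) auto
    ultimately show ?thesis by blast
  qed
  ultimately have "?R = {0} \<or> ?K = {0}"
    using g_indecomposable[OF j] unfolding indecomposable_def by blast
  then show ?thesis
  proof
    assume "?R = {0}"
    then have "proj j (p x) = 0" if "x \<in> g j" for x
      using that unfolding \<phi>_def by blast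
    then have "central (p x)" if "x \<in> g j" for x
      using centroid_off_diagonal_central[OF p j that] that by simp
    then show ?thesis by blast
  next
    assume K: "?K = {0}"
    have "\<phi> x = x" if "x \<in> g j" for x
    proof -
      have "x - \<phi> x \<in> ?K"
        using that sub \<phi>_in cen \<phi>_idem by (simp add: subspace_diff centroid_diff)
      then show ?thesis using K by simp
    qed
    then show ?thesis
      using centroid_off_diagonal_central[OF p j] by (metis \<phi>_def)
  qed
qed

end

section \<open>Inner products adapted to a partition of the summands\<close>

text \<open>
  \<open>\<beta>\<close> labels each summand with its block. The non-orthogonality within a block is demanded between
  derived ideals, because there the projection to a factor is exactly \<open>0\<close> or \<open>1\<close>, whereas on the
  whole summand this is known at first only modulo central elements.
\<close>

locale block_metric = nonabelian_decomposition scale br k g + hermitian_space scale cj pos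
  for scale :: "'k::field \<Rightarrow> 'v::ab_group_add \<Rightarrow> 'v" and br :: "'v \<Rightarrow> 'v \<Rightarrow> 'v"
    and k :: nat and g :: "nat \<Rightarrow> 'v set" and cj :: "'k \<Rightarrow> 'k" and pos :: "'k \<Rightarrow> bool" +
  fixes ip :: "'v \<Rightarrow> 'v \<Rightarrow> 'k" and \<beta> :: "nat \<Rightarrow> nat"
  assumes ip: "inner_product ip"
    and distinct_blocks: "\<lbrakk>i \<in> {1..k}; j \<in> {1..k}; \<beta> i \<noteq> \<beta> j; x \<in> g i; y \<in> g j\<rbrakk> \<Longrightarrow> ip x y = 0"
    and same_block: "\<lbrakk>i \<in> {1..k}; j \<in> {1..k}; \<beta> i = \<beta> j\<rbrakk> \<Longrightarrow>
      \<exists>v\<in>bracket (g i) (g i). \<exists>w\<in>bracket (g j) (g j). ip v w \<noteq> 0"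
begin

lemmas ip_simps = ip_add_left[OF ip] ip_add_right[OF ip] ip_diff_left[OF ip] ip_diff_right[OF ip]
  ip_sum_left[OF ip] ip_sum_right[OF ip] ip_scale_left[OF ip] ip_zero_left[OF ip] ip_zero_right[OF ip]

text \<open>
  The orthogonal projection to a factor is characterised by \<open>p x \<in> I\<close> and \<open>x - p x \<bottom> I\<close>; as \<open>I\<close> and its
  orthogonal complement are both ideals, uniqueness forces \<open>p\<close> into the centroid.
\<close>

lemma factor_projection:
  assumes I: "factor ip UNIV I"
  obtains p where "in_centroid p" "\<And>x. p x \<in> I" "\<And>x y. y \<in> I \<Longrightarrow> ip (x - p x) y = 0"
proof -
  have idI: "lie_ideal UNIV I" and idO: "lie_ideal UNIV (orth_compl ip UNIV I)"
    using I by (auto simp: factor_def)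
  have sub: "subspace I" using idI by (simp add: lie_ideal_def)
  obtain B where B: "B \<subseteq> I" "independent B" "I \<subseteq> span B"
    by (rule maximal_independent_subset)
  obtain S where S: "finite S" "span S = UNIV" using fin_dim by blast
  have "finite B" using independent_span_bound[OF S(1) B(2)] S(2) by simp
  moreover have spB: "span B = I" using B sub by (simp add: span_minimal subset_antisym)
  ultimately have "\<exists>a\<in>I. \<forall>y\<in>I. ip (x - a) y = 0" for x
    using orthogonal_projection_span[OF ip, of B x] by simp
  then obtain p where p: "\<And>x. p x \<in> I" "\<And>x y. y \<in> I \<Longrightarrow> ip (x - p x) y = 0" by metis
  have uniq: "p x = a" if "a \<in> I" "x - a \<in> orth_compl ip UNIV I" for x a
  proof -
    have d: "p x - a \<in> I" using p(1) that(1) sub by (simp add: subspace_diff)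
    have "p x - a = (x - a) - (x - p x)" by simp
    then have "ip (p x - a) (p x - a) = ip (x - a) (p x - a) - ip (x - p x) (p x - a)"
      by (metis ip_diff_left[OF ip])
    also have "\<dots> = 0" using that(2) p(2) d by (simp add: orth_compl_def)
    finally show ?thesis by (simp add: ip_self_eq_zero[OF ip])
  qed
  have orth: "x - p x \<in> orth_compl ip UNIV I" for x using p(2) by (simp add: orth_compl_def)
  have "p (x + y) = p x + p y" for x y
  proof (rule uniq)
    have "(x - p x) + (y - p y) \<in> orth_compl ip UNIV I"
      using orth idO by (intro subspace_add) (auto simp: lie_ideal_def)
    then show "x + y - (p x + p y) \<in> orth_compl ip UNIV I" by (simp add: algebra_simps)
  qed (simp add: p(1) sub subspace_add)
  moreover have "p (scale c x) = scale c (p x)" for c x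
  proof (rule uniq)
    have "scale c (x - p x) \<in> orth_compl ip UNIV I"
      using orth idO by (intro subspace_scale) (auto simp: lie_ideal_def)
    then show "scale c x - scale c (p x) \<in> orth_compl ip UNIV I"
      by (simp add: scale_right_diff_distrib)
  qed (simp add: p(1) sub subspace_scale)
  moreover have "p (br x y) = br x (p y)" for x y
  proof (rule uniq)
    have "br x (y - p y) \<in> orth_compl ip UNIV I"
      using orth idO by (auto simp: lie_ideal_def)
    then show "br x y - br x (p y) \<in> orth_compl ip UNIV I" by (simp add: br_diff_right)
  qed (use p(1) idI in \<open>simp add: lie_ideal_def\<close>)
  ultimately have "in_centroid p" by (simp add: in_centroid_def)
  then show thesis using that p by blast
qed

text \<open>
  The decomposition \<open>p = \<Phi> + N\<close> of the introduction: the self-adjoint part \<open>N\<close> squares to zero, so it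
  vanishes.
\<close>

lemma factor_projection_explicit:
  assumes p: "in_centroid p" and pI: "\<And>x. p x \<in> I" and orth: "\<And>x y. y \<in> I \<Longrightarrow> ip (x - p x) y = 0"
  obtains T where "T \<subseteq> {1..k}" "\<And>x. p x = (\<Sum>j\<in>T. proj j x)"
    "\<And>i j. i \<in> {1..k} \<Longrightarrow> j \<in> {1..k} \<Longrightarrow> \<beta> i = \<beta> j \<Longrightarrow> i \<in> T \<longleftrightarrow> j \<in> T"
proof -
  have orth': "ip y (x - p x) = 0" if "y \<in> I" for x y
    using orth[OF that] ip_orthogonal_sym[OF ip] by blast
  have idem: "p (p x) = p x" for x
  proof -
    let ?d = "p x - p (p x)"
    have "?d = p (x - p x)" using p by (simp add: centroid_diff)
    then have "?d \<in> I" using pI by simp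
    then have "ip ?d ?d = 0" by (rule orth)
    then show ?thesis by (simp add: ip_self_eq_zero[OF ip])
  qed
  have p_selfadj: "ip (p x) y = ip x (p y)" for x y
    using orth[OF pI, of x y] orth'[OF pI, of x y] by (simp add: ip_simps)
  define T where "T = {j \<in> {1..k}. \<forall>x\<in>g j. central (p x - x)}"
  have TJ: "T \<subseteq> {1..k}" by (auto simp: T_def)
  have fix_T: "p x = x" if "j \<in> T" "x \<in> bracket (g j) (g j)" for j x
  proof -
    have "p x - x = 0"
      using that in_centroid_diff[OF p in_centroid_id]
      by (intro centroid_kills_bracket[where p = "\<lambda>x. p x - x" and B = "g j"]) (auto simp: T_def)
    then show ?thesis by simp
  qed
  have notT: "central (p x)" if "j \<in> {1..k} - T" "x \<in> g j" for j x
    using that idempotent_centroid_dichotomy[OF p idem, of j] unfolding T_def by blast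
  have kill_notT: "p x = 0" if "j \<in> {1..k} - T" "x \<in> bracket (g j) (g j)" for j x
    using that notT p by (intro centroid_kills_bracket[where B = "g j"]) auto
  \<comment> \<open>Otherwise the linking elements \<open>v\<close> and \<open>w\<close> would lie in \<open>I\<close> and in its orthogonal complement.\<close>
  have T_imp: "j \<in> T" if ij: "i \<in> T" "j \<in> {1..k}" "\<beta> i = \<beta> j" for i j
  proof (rule ccontr)
    assume "j \<notin> T"
    obtain v w where vw: "v \<in> bracket (g i) (g i)" "w \<in> bracket (g j) (g j)" "ip v w \<noteq> 0"
      using same_block[of i j] ij TJ by blast
    have "ip v w = ip (p v) w" using fix_T[OF ij(1) vw(1)] by simp
    also have "\<dots> = ip v (p w)" by (rule p_selfadj)
    also have "\<dots> = 0" using kill_notT[of j w] ij(2) \<open>j \<notin> T\<close> vw(2) by (simp add: ip_simps)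
    finally show False using vw(3) by blast
  qed
  have T_block: "i \<in> T \<longleftrightarrow> j \<in> T" if "i \<in> {1..k}" "j \<in> {1..k}" "\<beta> i = \<beta> j" for i j
    using T_imp that by metis
  define \<Phi> where "\<Phi> x = (\<Sum>j\<in>T. proj j x)" for x
  define N where "N x = p x - \<Phi> x" for x
  have cent_\<Phi>: "in_centroid \<Phi>"
    unfolding \<Phi>_def using TJ in_centroid_proj by (intro in_centroid_sum) auto
  have cent_N: "in_centroid N" unfolding N_def by (rule in_centroid_diff[OF p cent_\<Phi>])
  have compl: "x - \<Phi> x = (\<Sum>j\<in>{1..k} - T. proj j x)" for x
    using TJ sum_proj[of x] by (simp add: \<Phi>_def sum_diff)
  have \<Phi>_orth: "ip (\<Phi> x) (y - \<Phi> y) = 0" for x y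
  proof -
    have "ip (proj i x) (proj j y) = 0" if "i \<in> T" "j \<in> {1..k} - T" for i j
    proof -
      have "i \<in> {1..k}" "j \<in> {1..k}" "\<beta> i \<noteq> \<beta> j" using that TJ T_imp by blast+
      then show ?thesis using proj_in by (intro distinct_blocks[of i j])
    qed
    then show ?thesis unfolding compl by (simp add: \<Phi>_def ip_simps)
  qed
  have \<Phi>_selfadj: "ip (\<Phi> x) y = ip x (\<Phi> y)" for x y
  proof -
    have "ip (\<Phi> x) y = ip (\<Phi> x) (\<Phi> y)" using \<Phi>_orth[of x y] by (simp add: ip_simps)
    moreover have "ip (x - \<Phi> x) (\<Phi> y) = 0"
      using \<Phi>_orth[of y x] ip_orthogonal_sym[OF ip] by blast
    ultimately show ?thesis by (simp add: ip_simps)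
  qed
  have N_g: "central (N x)" if j: "j \<in> {1..k}" and x: "x \<in> g j" for j x
  proof (cases "j \<in> T")
    case True
    then have "\<Phi> x = (\<Sum>i\<in>T. if i = j then x else 0)"
      unfolding \<Phi>_def using TJ proj_of_g[OF _ j x] by (intro sum.cong) auto
    then have "\<Phi> x = x" using True TJ finite_subset by (simp add: finite_subset[OF TJ])
    then show ?thesis using True x by (simp add: N_def T_def)
  next
    case False
    then have "\<Phi> x = (\<Sum>i\<in>T. 0)"
      unfolding \<Phi>_def using TJ proj_of_g[OF _ j x] by (intro sum.cong) auto
    then show ?thesis using notT[of j x] False j x by (simp add: N_def)
  qed
  have N_central: "central (N x)" for x
  proof -
    have "central (\<Sum>j=1..k. N (proj j x))" using N_g[OF _ proj_in] by (intro central_sum) auto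
    moreover have "(\<Sum>j=1..k. N (proj j x)) = N x"
      using centroid_sum_apply[OF cent_N, of "\<lambda>j. proj j x" "{1..k}"] by (simp add: sum_proj)
    ultimately show ?thesis by simp
  qed
  \<comment> \<open>\<open>N x\<close> is central, thus a combination of brackets, and \<open>N\<close> kills brackets.\<close>
  have N_N: "N (N x) = 0" for x
    using cent_N N_central central_in_bracket[OF N_central]
    by (intro centroid_kills_bracket[where B = UNIV]) auto
  have N_selfadj: "ip (N x) y = ip x (N y)" for x y
    using p_selfadj[of x y] \<Phi>_selfadj[of x y] by (simp only: N_def ip_simps)
  have "ip (N x) (N x) = 0" for x
    unfolding N_selfadj[of x "N x"] N_N by (rule ip_zero_right[OF ip])
  then have "N x = 0" for x using ip_self_eq_zero[OF ip] by blast
  then have "p x = (\<Sum>j\<in>T. proj j x)" for x unfolding N_def \<Phi>_def right_minus_eq .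
  then show thesis using that[OF TJ] T_block by blast
qed

text \<open>
  The sum of the summands labelled \<open>b\<close>, described by the vanishing of the other components, which
  makes it visibly an ideal.
\<close>

definition block :: "nat \<Rightarrow> 'v set" where
  "block b = {x. \<forall>j\<in>{1..k}. \<beta> j \<noteq> b \<longrightarrow> proj j x = 0}"

definition block_proj :: "nat \<Rightarrow> 'v \<Rightarrow> 'v" where
  "block_proj b x = (\<Sum>j\<in>{j \<in> {1..k}. \<beta> j = b}. proj j x)"

lemma factor_contains_or_orthogonal_block:
  assumes "factor ip UNIV I"
  shows "block b \<subseteq> I \<or> block b \<subseteq> orth_compl ip UNIV I"
proof -
  obtain p where p: "in_centroid p" "\<And>x. p x \<in> I" "\<And>x y. y \<in> I \<Longrightarrow> ip (x - p x) y = 0"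
    using factor_projection[OF assms] by metis
  obtain T where T: "T \<subseteq> {1..k}" "\<And>x. p x = (\<Sum>j\<in>T. proj j x)"
    "\<And>i j. i \<in> {1..k} \<Longrightarrow> j \<in> {1..k} \<Longrightarrow> \<beta> i = \<beta> j \<Longrightarrow> i \<in> T \<longleftrightarrow> j \<in> T"
    using factor_projection_explicit[OF p] by metis
  show ?thesis
  proof (cases "\<exists>i\<in>T. \<beta> i = b")
    case True
    then obtain i where i: "i \<in> T" "\<beta> i = b" by blast
    have "p x = x" if "x \<in> block b" for x
    proof -
      have "(\<Sum>j\<in>T. proj j x) = (\<Sum>j=1..k. proj j x)"
      proof (rule sum.mono_neutral_left)
        have "\<beta> j \<noteq> b" if "j \<in> {1..k} - T" for j
          using that i T(1) T(3)[of i j] by auto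
        then show "\<forall>j\<in>{1..k} - T. proj j x = 0" using that by (auto simp: block_def)
      qed (use T(1) in auto)
      then show ?thesis by (simp add: T(2) sum_proj)
    qed
    then have "block b \<subseteq> I" using p(2) by (metis subsetI)
    then show ?thesis by blast
  next
    case False
    have "p x = 0" if "x \<in> block b" for x
      using that False T(1) by (auto simp: T(2) block_def intro!: sum.neutral)
    then have "ip x y = 0" if "x \<in> block b" "y \<in> I" for x y
      using p(3)[OF that(2), of x] that(1) by simp
    then have "block b \<subseteq> orth_compl ip UNIV I" by (auto simp: orth_compl_def)
    then show ?thesis by blast
  qed
qed

lemma block_proj_in: "block_proj b x \<in> block b"
proof -
  have "proj j (block_proj b x) = 0" if j: "j \<in> {1..k}" "\<beta> j \<noteq> b" for j
  proof -
    have "proj j (block_proj b x) = (\<Sum>i\<in>{i \<in> {1..k}. \<beta> i = b}. proj j (proj i x))"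
      unfolding block_proj_def using j in_centroid_proj by (simp add: centroid_sum_apply)
    also have "\<dots> = 0"
      using j proj_of_g[OF j(1) _ proj_in] by (intro sum.neutral) auto
    finally show ?thesis .
  qed
  then show ?thesis by (simp add: block_def)
qed

lemma block_proj_fixes: "x \<in> block b \<Longrightarrow> block_proj b x = x"
proof -
  assume x: "x \<in> block b"
  have "block_proj b x = (\<Sum>j=1..k. proj j x)"
    unfolding block_proj_def using x by (intro sum.mono_neutral_left) (auto simp: block_def)
  then show ?thesis by (simp add: sum_proj)
qed

lemma in_centroid_block_proj: "in_centroid (block_proj b)"
  unfolding block_proj_def using in_centroid_proj by (intro in_centroid_sum) auto

lemma sum_block_proj: "(\<Sum>b\<in>\<beta> ` {1..k}. block_proj b x) = x"
proof -
  have "(\<Sum>b\<in>\<beta> ` {1..k}. block_proj b x) = (\<Sum>j=1..k. proj j x)"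
    unfolding block_proj_def by (rule sum.image_gen[symmetric]) simp
  then show ?thesis by (simp only: sum_proj)
qed

lemma subspace_block: "subspace (block b)"
  unfolding subspace_def block_def
  by (auto simp: centroid_add[OF in_centroid_proj] centroid_scale[OF in_centroid_proj]
      centroid_zero[OF in_centroid_proj])

lemma block_ideal: "lie_ideal UNIV (block b)"
  unfolding lie_ideal_def using subspace_block
  by (auto simp: block_def centroid_br[OF in_centroid_proj])

lemma g_in_block: "j \<in> {1..k} \<Longrightarrow> g j \<subseteq> block (\<beta> j)"
  by (auto simp: block_def proj_of_g)

lemma blocks_orthogonal:
  assumes "b \<noteq> c" "x \<in> block b" "y \<in> block c" shows "ip x y = 0"
proof -
  have "ip (block_proj b x) (block_proj c y) = 0"
  proof -
    have "ip (proj i x) (proj j y) = 0"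
      if "i \<in> {i \<in> {1..k}. \<beta> i = b}" "j \<in> {j \<in> {1..k}. \<beta> j = c}" for i j
      using that assms(1) proj_in by (intro distinct_blocks[of i j]) auto
    then show ?thesis unfolding block_proj_def ip_simps by (intro sum.neutral ballI)
  qed
  then show ?thesis using assms by (simp add: block_proj_fixes)
qed

lemma orthogonal_of_distinct_blocks:
  assumes "M \<in> range block" "N \<in> range block" "M \<noteq> N" "x \<in> M" "y \<in> N"
  shows "ip x y = 0"
proof -
  obtain b c where "M = block b" "N = block c" using assms(1,2) by blast
  then show ?thesis using assms(3-5) by (intro blocks_orthogonal[of b c]) auto
qed

lemma orthogonal_to_block_iff: "(\<forall>y\<in>block b. ip x y = 0) \<longleftrightarrow> block_proj b x = 0"
proof -
  have x: "ip x y = ip (block_proj b x) y" if y: "y \<in> block b" for y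
  proof -
    have "(\<Sum>j\<in>{1..k} - {j \<in> {1..k}. \<beta> j = b}. proj j x) = (\<Sum>j=1..k. proj j x) - block_proj b x"
      unfolding block_proj_def by (intro sum_diff) auto
    then have "x - block_proj b x = (\<Sum>j\<in>{1..k} - {j \<in> {1..k}. \<beta> j = b}. proj j x)"
      by (simp only: sum_proj)
    moreover have "ip (proj j x) y = 0" if "j \<in> {1..k} - {j \<in> {1..k}. \<beta> j = b}" for j
      using that y g_in_block[of j] proj_in[of j x] by (intro blocks_orthogonal[of "\<beta> j" b]) auto
    ultimately have "ip (x - block_proj b x) y = 0" by (simp add: ip_simps)
    then show ?thesis by (simp add: ip_simps)
  qed
  show ?thesis
    using x block_proj_in ip_self_eq_zero[OF ip] by (metis ip_zero_left[OF ip])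
qed

lemma block_nonabelian:
  assumes "b \<in> \<beta> ` {1..k}" shows "bracket (block b) (block b) \<noteq> {0}"
proof -
  obtain j where j: "j \<in> {1..k}" "\<beta> j = b" using assms by blast
  have "bracket (g j) (g j) \<subseteq> bracket (block b) (block b)"
    using g_in_block[OF j(1)] j(2) by (intro bracket_mono) auto
  moreover have "bracket (g j) (g j) \<noteq> {0}" using nonabelian j(1) by blast
  moreover have "0 \<in> bracket (g j) (g j)" by (simp add: bracket_def span_zero)
  ultimately show ?thesis by blast
qed

lemma block_nonzero: "b \<in> \<beta> ` {1..k} \<Longrightarrow> block b \<noteq> {0}"
proof
  assume "b \<in> \<beta> ` {1..k}" and b: "block b = {0}"
  then have "bracket {0} {0} \<noteq> {0}" using block_nonabelian[of b] by simp
  moreover have "bracket {0} {0} \<subseteq> {0}" by (rule bracket_least) auto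
  moreover have "0 \<in> bracket {0} {0}" by (simp add: bracket_def span_zero)
  ultimately show False by blast
qed

lemma block_orth_compl_ideal: "lie_ideal UNIV (orth_compl ip UNIV (block b))"
proof -
  have "orth_compl ip UNIV (block b) = {x. block_proj b x \<in> {0}}"
    by (simp add: orth_compl_def orthogonal_to_block_iff)
  moreover have "subspace {x. block_proj b x \<in> {0}}"
    by (intro subspace_centroid_preimage in_centroid_block_proj) simp
  ultimately show ?thesis
    by (auto simp: lie_ideal_def centroid_br[OF in_centroid_block_proj])
qed

lemma block_factor: "factor ip UNIV (block b)"
  by (simp add: factor_def block_ideal block_orth_compl_ideal)

text \<open>
  The other blocks act trivially on a block and are orthogonal to it. So an ideal of the block is an
  ideal of the whole algebra, and the orthogonal complement only grows by the other blocks.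
\<close>

lemma factor_of_block_is_factor:
  assumes "factor ip (block b) I" shows "factor ip UNIV I"
proof -
  have I: "subspace I" "I \<subseteq> block b" "\<And>x y. x \<in> block b \<Longrightarrow> y \<in> I \<Longrightarrow> br x y \<in> I"
    and O: "lie_ideal (block b) (orth_compl ip (block b) I)"
    using assms by (auto simp: factor_def lie_ideal_def)
  have br_block: "br x y = br (block_proj b x) y" if y: "y \<in> block b" for x y
  proof -
    have "br x y = block_proj b (br x y)"
      using y block_ideal by (simp add: lie_ideal_def block_proj_fixes)
    also have "\<dots> = - block_proj b (br y x)"
      using centroid_diff[OF in_centroid_block_proj, of b 0 "br y x"]
      by (simp add: br_anticomm[of x y] centroid_zero[OF in_centroid_block_proj])
    also have "\<dots> = - br y (block_proj b x)" by (simp add: centroid_br[OF in_centroid_block_proj])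
    also have "\<dots> = br (block_proj b x) y" by (simp add: br_anticomm[of _ y])
    finally show ?thesis .
  qed
  have ip_block: "ip x y = ip (block_proj b x) y" if "y \<in> I" for x y
  proof -
    have "block_proj b (x - block_proj b x) = 0"
      by (simp add: centroid_diff[OF in_centroid_block_proj] block_proj_fixes block_proj_in)
    then have "ip (x - block_proj b x) y = 0"
      using orthogonal_to_block_iff that I(2) by blast
    then show ?thesis by (simp add: ip_simps)
  qed
  have oc: "orth_compl ip UNIV I = {x. block_proj b x \<in> orth_compl ip (block b) I}"
  proof (rule set_eqI)
    fix x
    have "(\<forall>y\<in>I. ip x y = 0) \<longleftrightarrow> (\<forall>y\<in>I. ip (block_proj b x) y = 0)"
      by (simp add: ip_block[of _ x])
    then show "x \<in> orth_compl ip UNIV I \<longleftrightarrow> x \<in> {x. block_proj b x \<in> orth_compl ip (block b) I}"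
      by (simp add: orth_compl_def block_proj_in)
  qed
  have "br x y \<in> I" if "y \<in> I" for x y
    using I(3)[OF block_proj_in that, of x] br_block[of y x] I(2) that by auto
  then have "lie_ideal UNIV I" using I(1) by (simp add: lie_ideal_def)
  moreover have "subspace (orth_compl ip UNIV I)"
    unfolding oc using O in_centroid_block_proj
    by (intro subspace_centroid_preimage) (auto simp: lie_ideal_def)
  moreover have "br x y \<in> orth_compl ip UNIV I" if "y \<in> orth_compl ip UNIV I" for x y
  proof -
    have "br (block_proj b x) (block_proj b y) \<in> orth_compl ip (block b) I"
      using that O block_proj_in by (simp add: oc lie_ideal_def)
    then show ?thesis
      by (simp add: oc centroid_br[OF in_centroid_block_proj] br_block[OF block_proj_in, of x])
  qed
  ultimately show ?thesis by (auto simp: factor_def lie_ideal_def)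
qed

text \<open>
  A factor \<open>I\<close> of the block contains the block or is orthogonal to it, hence to itself.
\<close>

lemma block_irreducible:
  assumes "b \<in> \<beta> ` {1..k}" shows "metric_irreducible ip (block b)"
  unfolding metric_irreducible_def
proof (intro conjI allI impI)
  show "block b \<noteq> {0}" using assms by (rule block_nonzero)
  fix I assume I: "factor ip (block b) I"
  have sub: "I \<subseteq> block b" "0 \<in> I" using I by (auto simp: factor_def lie_ideal_def subspace_0)
  from factor_contains_or_orthogonal_block[OF factor_of_block_is_factor[OF I], of b]
  show "I = {0} \<or> I = block b"
  proof
    assume "block b \<subseteq> orth_compl ip UNIV I"
    then have "x = 0" if "x \<in> I" for x
      using that sub(1) ip_self_eq_zero[OF ip, of x] by (auto simp: orth_compl_def)
    then show ?thesis using sub(2) by blast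
  qed (use sub in blast)
qed

lemma factor_orthogonal_to_all_blocks:
  assumes I: "factor ip UNIV I" and "\<And>b. b \<in> \<beta> ` {1..k} \<Longrightarrow> \<not> block b \<subseteq> I"
  shows "I = {0}"
proof -
  have "block b \<subseteq> orth_compl ip UNIV I" if "b \<in> \<beta> ` {1..k}" for b
    using factor_contains_or_orthogonal_block[OF I, of b] assms(2)[OF that] by blast
  then have "ip (\<Sum>b\<in>\<beta> ` {1..k}. block_proj b x) x = 0" if "x \<in> I" for x
    using that block_proj_in by (force simp: ip_simps orth_compl_def intro!: sum.neutral)
  then have "x = 0" if "x \<in> I" for x
    using that ip_self_eq_zero[OF ip, of x] by (simp add: sum_block_proj)
  moreover have "0 \<in> I" using I by (auto simp: factor_def lie_ideal_def subspace_0)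
  ultimately show ?thesis by blast
qed

lemma no_abelian_factor: "no_abelian_factor ip"
  unfolding no_abelian_factor_def
proof (intro allI impI, elim conjE)
  fix I assume I: "factor ip UNIV I" "bracket I I = {0}"
  have "\<not> block b \<subseteq> I" if "b \<in> \<beta> ` {1..k}" for b
  proof
    assume "block b \<subseteq> I"
    then have "bracket (block b) (block b) \<subseteq> {0}" using bracket_mono I(2) by metis
    moreover have "0 \<in> bracket (block b) (block b)" by (simp add: bracket_def span_zero)
    ultimately show False using block_nonabelian[OF that] by blast
  qed
  then show "I = {0}" by (rule factor_orthogonal_to_all_blocks[OF I(1)])
qed

lemma inj_on_block: "inj_on block (\<beta> ` {1..k})"
proof (rule inj_onI, rule ccontr)
  fix b c assume bc: "b \<in> \<beta> ` {1..k}" "block b = block c" "b \<noteq> c"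
  have "x = 0" if "x \<in> block b" for x
    using blocks_orthogonal[OF bc(3) that] that bc(2) ip_self_eq_zero[OF ip] by auto
  moreover have "0 \<in> block b" using subspace_block by (rule subspace_0)
  ultimately show False using block_nonzero[OF bc(1)] by blast
qed

lemma blocks_direct_sum: "direct_sum_of UNIV (block ` \<beta> ` {1..k}) (\<lambda>M. M)"
  unfolding direct_sum_of_def
proof (intro conjI allI impI ballI)
  let ?C = "block ` \<beta> ` {1..k}"
  show fin: "finite ?C" by simp
  have "\<exists>f. x = (\<Sum>M\<in>?C. f M) \<and> (\<forall>M\<in>?C. f M \<in> M)" for x
  proof -
    define f where "f M = block_proj (inv_into (\<beta> ` {1..k}) block M) x" for M
    have f: "f (block b) = block_proj b x" if "b \<in> \<beta> ` {1..k}" for b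
      using that inj_on_block by (simp add: f_def)
    have "(\<Sum>M\<in>?C. f M) = (\<Sum>b\<in>\<beta> ` {1..k}. block_proj b x)"
      by (subst sum.reindex[OF inj_on_block]) (auto simp: f intro!: sum.cong)
    then have "x = (\<Sum>M\<in>?C. f M)" by (simp add: sum_block_proj)
    moreover have "\<forall>M\<in>?C. f M \<in> M" using f block_proj_in by auto
    ultimately show ?thesis by blast
  qed
  then show "UNIV = {\<Sum>M\<in>?C. f M |f. \<forall>M\<in>?C. f M \<in> M}" by blast
  fix f M assume f: "\<forall>M\<in>?C. f M \<in> M" "(\<Sum>M\<in>?C. f M) = 0" and M: "M \<in> ?C"
  have "ip (f N) (f M) = 0" if "N \<in> ?C" "N \<noteq> M" for N
    using that M f(1) by (intro orthogonal_of_distinct_blocks[of N M]) auto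
  then have "(\<Sum>N\<in>?C. ip (f N) (f M)) = (\<Sum>N\<in>?C. if N = M then ip (f M) (f M) else 0)"
    by (intro sum.cong) auto
  also have "\<dots> = ip (f M) (f M)" using M fin by simp
  finally have "ip (f M) (f M) = ip (\<Sum>N\<in>?C. f N) (f M)" by (simp only: ip_simps)
  then show "f M = 0" by (simp only: f(2) ip_simps ip_self_eq_zero[OF ip])
qed

lemma blocks_irreducible_decomposition: "irreducible_decomposition ip (block ` \<beta> ` {1..k})"
  unfolding irreducible_decomposition_def
proof (intro conjI ballI impI)
  show "direct_sum_of UNIV (block ` \<beta> ` {1..k}) (\<lambda>M. M)" by (rule blocks_direct_sum)
  fix M assume "M \<in> block ` \<beta> ` {1..k}"
  then obtain b where b: "b \<in> \<beta> ` {1..k}" "M = block b" by blast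
  show "factor ip UNIV M" unfolding b(2) by (rule block_factor)
  show "metric_irreducible ip M" unfolding b(2) using b(1) by (rule block_irreducible)
  fix N x y assume N: "N \<in> block ` \<beta> ` {1..k}" "M \<noteq> N" "x \<in> M" "y \<in> N"
  then show "ip x y = 0" using b(2) by (intro orthogonal_of_distinct_blocks[of M N]) auto
qed

text \<open>
  Each member \<open>M\<close> of a decomposition is a non-zero factor, so it contains a block, which is a factor
  of \<open>M\<close> and thus equal to \<open>M\<close>. Conversely, a block missing from the decomposition would be orthogonal
  to all its members, that is, to everything.
\<close>

lemma irreducible_decomposition_unique:
  assumes D: "irreducible_decomposition ip D"
  shows "D = block ` \<beta> ` {1..k}"
proof
  have fac: "factor ip UNIV M" and irr: "metric_irreducible ip M" if "M \<in> D" for M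
    using D that unfolding irreducible_decomposition_def by blast+
  show sub: "D \<subseteq> block ` \<beta> ` {1..k}"
  proof
    fix M assume M: "M \<in> D"
    then have "M \<noteq> {0}" using irr by (simp add: metric_irreducible_def)
    then obtain b where b: "b \<in> \<beta> ` {1..k}" "block b \<subseteq> M"
      using factor_orthogonal_to_all_blocks[OF fac[OF M]] by blast
    have idM: "lie_ideal UNIV M" using fac[OF M] by (simp add: factor_def)
    have "orth_compl ip M (block b) = M \<inter> orth_compl ip UNIV (block b)"
      by (auto simp: orth_compl_def)
    then have "factor ip M (block b)"
      using b(2) idM block_ideal[of b] block_orth_compl_ideal[of b]
      by (auto simp: factor_def lie_ideal_def subspace_inter)
    then have "block b = M"
      using irr[OF M] block_nonzero[OF b(1)] by (auto simp: metric_irreducible_def)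
    then show "M \<in> block ` \<beta> ` {1..k}" using b(1) by blast
  qed
  show "block ` \<beta> ` {1..k} \<subseteq> D"
  proof (rule subsetI, rule ccontr)
    fix M assume M: "M \<in> block ` \<beta> ` {1..k}" and MD: "M \<notin> D"
    obtain b where b: "b \<in> \<beta> ` {1..k}" "M = block b" using M by blast
    have orth: "ip x y = 0" if "N \<in> D" "x \<in> N" "y \<in> M" for N x y
      using that sub MD b by (intro orthogonal_of_distinct_blocks[of N M]) auto
    have "x = 0" if "x \<in> M" for x
    proof -
      have "UNIV = {\<Sum>N\<in>D. f N | f. \<forall>N\<in>D. f N \<in> N}"
        using D unfolding irreducible_decomposition_def direct_sum_of_def by blast
      then have "x \<in> {\<Sum>N\<in>D. f N | f. \<forall>N\<in>D. f N \<in> N}" using UNIV_I by (rule subst)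
      then obtain f where f: "x = (\<Sum>N\<in>D. f N)" "\<forall>N\<in>D. f N \<in> N" by blast
      have "ip (\<Sum>N\<in>D. f N) x = 0"
        using orth f(2) that by (simp add: ip_simps)
      then show ?thesis using f(1) ip_self_eq_zero[OF ip] by simp
    qed
    moreover have "0 \<in> M" using b(2) subspace_block subspace_0 by blast
    ultimately show False using block_nonzero[OF b(1)] b(2) by blast
  qed
qed

lemma number_of_irreducible_components:
  "has_exactly_irreducible_components ip (card (\<beta> ` {1..k}))"
  unfolding has_exactly_irreducible_components_def
  using no_abelian_factor blocks_irreducible_decomposition irreducible_decomposition_unique
    card_image[OF inj_on_block] by blast

end

section \<open>Existence of adapted inner products\<close>

locale hermitian_nonabelian_decomposition =
  nonabelian_decomposition scale br k g + hermitian_space scale cj pos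
  for scale :: "'k::field \<Rightarrow> 'v::ab_group_add \<Rightarrow> 'v" and br :: "'v \<Rightarrow> 'v \<Rightarrow> 'v"
    and k :: nat and g :: "nat \<Rightarrow> 'v set" and cj :: "'k \<Rightarrow> 'k" and pos :: "'k \<Rightarrow> bool"
begin

text \<open>
  The first sum in \<open>ip\<close> is definite and makes all summands orthogonal. The rank one terms \<open>\<nu> b\<close> keep
  it definite, do not mix distinct blocks, and give \<open>ip (v i) (v j) = e (v i) (v i) * cj (e (v j) (v j))\<close>
  for distinct summands of one block.
\<close>

lemma block_metric_exists: "\<exists>ip. block_metric scale br k g cj pos ip \<beta>"
proof -
  obtain e where e: "inner_product e"
    using fin_dim inner_product_exists by blast
  note e_simps = ip_add_left[OF e] ip_scale_left[OF e] ip_zero_left[OF e] ip_zero_right[OF e]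
  have "\<exists>v. v \<in> bracket (g j) (g j) \<and> v \<noteq> 0" if "j \<in> {1..k}" for j
    using nonabelian[OF that] span_zero by (fastforce simp: bracket_def)
  then obtain v where v: "\<And>j. j \<in> {1..k} \<Longrightarrow> v j \<in> bracket (g j) (g j)"
      "\<And>j. j \<in> {1..k} \<Longrightarrow> v j \<noteq> 0"
    by metis
  have vg: "v j \<in> g j" if "j \<in> {1..k}" for j
    using bracket_least[OF g_subspace[OF that] br_in_g_right[OF that]] v(1)[OF that] by blast
  define \<nu> where "\<nu> b x = (\<Sum>j\<in>{j \<in> {1..k}. \<beta> j = b}. e (proj j x) (v j))" for b x
  define ip where "ip x y =
    (\<Sum>j=1..k. e (proj j x) (proj j y)) + (\<Sum>b\<in>\<beta> ` {1..k}. \<nu> b x * cj (\<nu> b y))" for x y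
  have \<nu>_g: "\<nu> b x = (if b = \<beta> j then e x (v j) else 0)" if j: "j \<in> {1..k}" "x \<in> g j" for b j x
  proof -
    have "\<nu> b x = (\<Sum>i\<in>{i \<in> {1..k}. \<beta> i = b}. if i = j then e x (v j) else 0)"
      unfolding \<nu>_def using proj_of_g[OF _ j] by (intro sum.cong) (auto simp: e_simps)
    then show ?thesis using j(1) by auto
  qed
  have ip_g: "ip x y = (if i = j then e x y else 0)
      + (if \<beta> i = \<beta> j then e x (v i) * cj (e y (v j)) else 0)"
    if ij: "i \<in> {1..k}" "j \<in> {1..k}" and xy: "x \<in> g i" "y \<in> g j" for i j x y
  proof -
    have "(\<Sum>l=1..k. e (proj l x) (proj l y)) = (\<Sum>l=1..k. if l = i then if i = j then e x y else 0 else 0)"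
      using proj_of_g[OF _ ij(1) xy(1)] proj_of_g[OF _ ij(2) xy(2)]
      by (intro sum.cong) (auto simp: e_simps)
    moreover have "(\<Sum>b\<in>\<beta> ` {1..k}. \<nu> b x * cj (\<nu> b y)) =
        (\<Sum>b\<in>\<beta> ` {1..k}. if b = \<beta> i then if \<beta> i = \<beta> j then e x (v i) * cj (e y (v j)) else 0 else 0)"
      using ij xy by (intro sum.cong) (auto simp: \<nu>_g[of i] \<nu>_g[of j])
    ultimately show ?thesis using ij(1) by (simp add: ip_def)
  qed
  have "inner_product ip"
    unfolding inner_product_def
  proof (intro conjI allI impI)
    have \<nu>_add: "\<nu> b (x + y) = \<nu> b x + \<nu> b y" for b x y
      by (simp add: \<nu>_def centroid_add[OF in_centroid_proj] e_simps sum.distrib)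
    have \<nu>_scale: "\<nu> b (scale c x) = c * \<nu> b x" for b c x
      by (simp add: \<nu>_def centroid_scale[OF in_centroid_proj] e_simps sum_distrib_left)
    show "ip (x + y) z = ip x z + ip y z" for x y z
      by (simp add: ip_def \<nu>_add centroid_add[OF in_centroid_proj] e_simps sum.distrib distrib_right)
    show "ip (scale c x) y = c * ip x y" for c x y
      by (simp add: ip_def \<nu>_scale centroid_scale[OF in_centroid_proj] e_simps
          sum_distrib_left distrib_left mult.assoc)
    have "cj (e (proj j x) (proj j y)) = e (proj j y) (proj j x)" for j x y
      by (rule ip_swap[OF e, symmetric])
    then show "ip y x = cj (ip x y)" for x y
      by (simp add: ip_def cj_add cj_sum cj_mult cj_cj mult.commute)
    fix x :: 'v assume "x \<noteq> 0"
    then obtain j where j: "j \<in> {1..k}" "proj j x \<noteq> 0"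
      using sum_proj[of x] by (metis sum.neutral)
    have "pos (\<Sum>j=1..k. e (proj j x) (proj j x))"
      using j ip_pos[OF e] ip_nonneg[OF e] by (intro pos_sum[of _ _ j]) auto
    then show "pos (ip x x)"
      unfolding ip_def by (intro pos_add_nonneg nonneg_sum nonneg_norm)
  qed
  moreover have "ip x y = 0"
    if "i \<in> {1..k}" "j \<in> {1..k}" "\<beta> i \<noteq> \<beta> j" "x \<in> g i" "y \<in> g j" for i j x y
    using ip_g[OF that(1,2,4,5)] that(3) by auto
  moreover have "\<exists>a\<in>bracket (g i) (g i). \<exists>b\<in>bracket (g j) (g j). ip a b \<noteq> 0"
    if ij: "i \<in> {1..k}" "j \<in> {1..k}" "\<beta> i = \<beta> j" for i j
  proof (cases "i = j")
    case True
    have "ip (v i) (v i) \<noteq> 0"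
      using ip_self_eq_zero[OF \<open>inner_product ip\<close>] v(2)[OF ij(1)] by blast
    then show ?thesis using v(1)[OF ij(1)] True by blast
  next
    case False
    have "ip (v i) (v j) = e (v i) (v i) * cj (e (v j) (v j))"
      using ip_g[OF ij(1,2) vg[OF ij(1)] vg[OF ij(2)]] False ij(3) by simp
    then have "ip (v i) (v j) \<noteq> 0"
      using v(2) ij(1,2) ip_self_eq_zero[OF e] by simp
    then show ?thesis using v(1) ij(1,2) by blast
  qed
  ultimately have "block_metric scale br k g cj pos ip \<beta>"
    by unfold_locales
  then show ?thesis by blast
qed

lemma prescribed_number_of_components:
  assumes "l \<in> {1..k}"
  shows "\<exists>ip. inner_product ip \<and> has_exactly_irreducible_components ip l"
proof -
  \<comment> \<open>Any surjection from \<open>{1..k}\<close> to \<open>{1..l}\<close> would do.\<close>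
  define \<beta> where "\<beta> j = min j l" for j
  obtain ip where bm: "block_metric scale br k g cj pos ip \<beta>" using block_metric_exists by blast
  interpret block_metric scale br k g cj pos ip \<beta> by (rule bm)
  have "\<beta> ` {1..k} = {1..l}"
  proof
    show "\<beta> ` {1..k} \<subseteq> {1..l}" using assms by (auto simp: \<beta>_def)
    show "{1..l} \<subseteq> \<beta> ` {1..k}"
    proof
      fix b assume "b \<in> {1..l}"
      then have "b = \<beta> b" "b \<in> {1..k}" using assms by (auto simp: \<beta>_def)
      then show "b \<in> \<beta> ` {1..k}" by blast
    qed
  qed
  then show ?thesis
    using ip number_of_irreducible_components by auto
qed

end

lemma real_positive_conjugation: "positive_conjugation (\<lambda>a::real. a) (\<lambda>a. a > 0)"
  by unfold_locales (auto simp: zero_less_mult_iff)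

lemma complex_positive_conjugation: "positive_conjugation cnj (\<lambda>a. Re a > 0)"
proof unfold_locales
  fix c :: complex assume "c \<noteq> 0"
  then show "Re (c * cnj c) > 0" by (simp add: complex_neq_0 power2_eq_square)
qed auto

theorem corollary5p6:
  fixes scR :: "real \<Rightarrow> 'a::ab_group_add \<Rightarrow> 'a" and brR :: "'a \<Rightarrow> 'a \<Rightarrow> 'a" and gR :: "nat \<Rightarrow> 'a set"
    and scC :: "complex \<Rightarrow> 'b::ab_group_add \<Rightarrow> 'b" and brC :: "'b \<Rightarrow> 'b \<Rightarrow> 'b" and gC :: "nat \<Rightarrow> 'b set"
    and k :: nat
  shows
    "(fin_dim_lie_algebra scR brR \<and>
      fin_dim_lie_algebra.indecomposable_decomposition scR brR k gR \<and>
      (\<forall>j\<in>{1..k}. fin_dim_lie_algebra.bracket scR brR (gR j) (gR j) \<noteq> {0}) \<longrightarrow>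
      (\<forall>l\<in>{1..k}. \<exists>ip. real_inner_product scR ip \<and>
         fin_dim_lie_algebra.has_exactly_irreducible_components scR brR ip l))
     \<and>
     (fin_dim_lie_algebra scC brC \<and>
      fin_dim_lie_algebra.indecomposable_decomposition scC brC k gC \<and>
      (\<forall>j\<in>{1..k}. fin_dim_lie_algebra.bracket scC brC (gC j) (gC j) \<noteq> {0}) \<longrightarrow>
      (\<forall>l\<in>{1..k}. \<exists>ip. complex_inner_product scC ip \<and>
         fin_dim_lie_algebra.has_exactly_irreducible_components scC brC ip l))"
proof (intro conjI impI ballI; elim conjE)
  fix l assume l: "l \<in> {1..k}" and lie: "fin_dim_lie_algebra scR brR"
    and dec: "fin_dim_lie_algebra.indecomposable_decomposition scR brR k gR"
      "\<forall>j\<in>{1..k}. fin_dim_lie_algebra.bracket scR brR (gR j) (gR j) \<noteq> {0}"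
  interpret fin_dim_lie_algebra scR brR by (rule lie)
  interpret positive_conjugation "\<lambda>a::real. a" "\<lambda>a. a > 0" by (rule real_positive_conjugation)
  interpret hermitian_nonabelian_decomposition scR brR k gR "\<lambda>a. a" "\<lambda>a. a > 0"
    using dec by unfold_locales auto
  show "\<exists>ip. real_inner_product scR ip \<and> has_exactly_irreducible_components ip l"
    using prescribed_number_of_components[OF l]
    unfolding inner_product_def real_inner_product_def .
next
  fix l assume l: "l \<in> {1..k}" and lie: "fin_dim_lie_algebra scC brC"
    and dec: "fin_dim_lie_algebra.indecomposable_decomposition scC brC k gC"
      "\<forall>j\<in>{1..k}. fin_dim_lie_algebra.bracket scC brC (gC j) (gC j) \<noteq> {0}"
  interpret fin_dim_lie_algebra scC brC by (rule lie)
  interpret positive_conjugation cnj "\<lambda>a. Re a > 0" by (rule complex_positive_conjugation)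
  interpret hermitian_nonabelian_decomposition scC brC k gC cnj "\<lambda>a. Re a > 0"
    using dec by unfold_locales auto
  show "\<exists>ip. complex_inner_product scC ip \<and> has_exactly_irreducible_components ip l"
    using prescribed_number_of_components[OF l]
    unfolding inner_product_def complex_inner_product_def .
qed

end
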